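(* Let $a,b,\chi$ be integers with $\chi\geq 3$, $\chi\geq b>1$ and $a\geq 2$, and suppose that either $\chi-b$ is even, or $\chi-b\geq 3$ is odd and $a>2$ is even. Then any graph $T^*_{a\chi+b,\chi}$ (constructed as described in the context) is an extremal $(a(\chi-1)+b-1\,|\,\chi)$-graph: it is $(a(\chi-1)+b-1)$-regular with chromatic number $\chi$, and every $(a(\chi-1)+b-1)$-regular graph with chromatic number $\chi$ has at least $a\chi+b$ vertices.
   Context: An $(r|\chi)$-graph is a simple finite $r$-regular graph with chromatic number $\chi$; it is extremal if it has minimum order among all $(r|\chi)$-graphs. Construction of $T^*_{n,\chi}$ with $n=a\chi+b$: start from the complete $\chi$-partite graph with parts $V_1,\dots,V_\chi$, where $|V_i|=a$ for $1\le i\le \chi-b$ and $|V_i|=a+1$ for $\chi-b<i\le\chi$ (two vertices adjacent iff in different parts). If $\chi-b$ is even, remove, for each $i\in\{1,3,5,\dots,\chi-b-1\}$, the edges of a perfect matching between $V_i$ and $V_{i+1}$. If $\chi-b\geq 3$ is odd and $a$ is even, split each of $V_1,V_2,V_3$ as $V_i=V_i'\cup V_i''$ with $|V_i'|=|V_i''|=a/2$, remove the edges of a perfect matching between $V_1'$ and $V_2''$, one between $V_2'$ and $V_3''$, and one between $V_3'$ and $V_1''$, and for each $i\in\{4,6,\dots,\chi-b-1\}$ remove the edges of a perfect matching between $V_i$ and $V_{i+1}$. The resulting graph is $T^*_{n,\chi}$. *)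

theory Defs
  imports Main
begin

text \<open>Finite simple undirected graphs are given by a vertex set \<open>V\<close> and a set \<open>E\<close> of
  two-element subsets of \<open>V\<close>.\<close>

definition simple_graph :: "'a set \<Rightarrow> 'a set set \<Rightarrow> bool" where
  "simple_graph V E \<longleftrightarrow> finite V \<and> (\<forall>e\<in>E. e \<subseteq> V \<and> card e = 2)"

definition degree :: "'a set set \<Rightarrow> 'a \<Rightarrow> nat" where
  "degree E v = card {e \<in> E. v \<in> e}"

definition regular :: "nat \<Rightarrow> 'a set \<Rightarrow> 'a set set \<Rightarrow> bool" where
  "regular r V E \<longleftrightarrow> (\<forall>v\<in>V. degree E v = r)"

definition proper_colouring :: "'a set \<Rightarrow> 'a set set \<Rightarrow> nat \<Rightarrow> ('a \<Rightarrow> nat) \<Rightarrow> bool" where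
  "proper_colouring V E k c \<longleftrightarrow>
     (\<forall>v\<in>V. c v < k) \<and> (\<forall>u\<in>V. \<forall>v\<in>V. {u, v} \<in> E \<longrightarrow> c u \<noteq> c v)"

text \<open>For a finite simple graph a proper colouring with \<open>card V\<close> colours exists, so
  the least number below is attained.\<close>

definition chromatic_number :: "'a set \<Rightarrow> 'a set set \<Rightarrow> nat" where
  "chromatic_number V E = (LEAST k. \<exists>c. proper_colouring V E k c)"

definition r_chi_graph :: "nat \<Rightarrow> nat \<Rightarrow> 'a set \<Rightarrow> 'a set set \<Rightarrow> bool" where
  "r_chi_graph r \<chi> V E \<longleftrightarrow>
     simple_graph V E \<and> regular r V E \<and> chromatic_number V E = \<chi>"

text \<open>HOL cannot quantify over types inside a formula, so the vertex type \<open>'b\<close> of the competing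
  graphs is a parameter. A theorem about \<^term>\<open>TYPE('b)\<close> with \<open>'b\<close> a free type variable covers
  all of them, in particular \<open>'b = nat\<close>, where every finite graph has an isomorphic copy.\<close>

definition extremal_graph ::
  "'b itself \<Rightarrow> nat \<Rightarrow> nat \<Rightarrow> 'a set \<Rightarrow> 'a set set \<Rightarrow> bool" where
  "extremal_graph (_ :: 'b itself) r \<chi> V E \<longleftrightarrow>
     r_chi_graph r \<chi> V E \<and>
     (\<forall>(V' :: 'b set) E'. r_chi_graph r \<chi> V' E' \<longrightarrow> card V \<le> card V')"

definition perfect_matching_between :: "'a set \<Rightarrow> 'a set \<Rightarrow> 'a set set \<Rightarrow> bool" where
  "perfect_matching_between X Y M \<longleftrightarrow>
     M \<subseteq> {{x, y} | x y. x \<in> X \<and> y \<in> Y} \<and> (\<forall>v \<in> X \<union> Y. \<exists>!e. e \<in> M \<and> v \<in> e)"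

text \<open>The parts are \<open>P 1, \<dots>, P \<chi>\<close>; values of \<open>P\<close> at other indices are irrelevant.\<close>

definition Tstar_parts :: "nat \<Rightarrow> nat \<Rightarrow> nat \<Rightarrow> (nat \<Rightarrow> 'a set) \<Rightarrow> bool" where
  "Tstar_parts a b \<chi> P \<longleftrightarrow>
     (\<forall>i\<in>{1..\<chi>}. finite (P i) \<and> card (P i) = (if i \<le> \<chi> - b then a else a + 1)) \<and>
     (\<forall>i\<in>{1..\<chi>}. \<forall>j\<in>{1..\<chi>}. i \<noteq> j \<longrightarrow> P i \<inter> P j = {})"

definition complete_multipartite_edges :: "nat \<Rightarrow> (nat \<Rightarrow> 'a set) \<Rightarrow> 'a set set" where
  "complete_multipartite_edges \<chi> P =
     {{u, v} | u v. \<exists>i\<in>{1..\<chi>}. \<exists>j\<in>{1..\<chi>}. i \<noteq> j \<and> u \<in> P i \<and> v \<in> P j}"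

text \<open>In the next two definitions \<open>m\<close> stands for \<open>\<chi> - b\<close> and \<open>R\<close> for the set of removed edges.
  In the first one, \<open>i\<close> ranges over \<open>1, 3, \<dots>, m - 1\<close> (no index if \<open>m = 0\<close>); in the second one,
  over \<open>4, 6, \<dots>, m - 1\<close> (no index if \<open>m = 3\<close>), and \<open>P' i\<close>, \<open>P'' i\<close> are the halves of \<open>P i\<close>.\<close>

definition removed_even :: "nat \<Rightarrow> (nat \<Rightarrow> 'a set) \<Rightarrow> 'a set set \<Rightarrow> bool" where
  "removed_even m P R \<longleftrightarrow>
     (\<exists>M. (\<forall>i. odd i \<and> i < m \<longrightarrow> perfect_matching_between (P i) (P (i + 1)) (M i)) \<and>
          R = (\<Union>i\<in>{i. odd i \<and> i < m}. M i))"

definition removed_odd :: "nat \<Rightarrow> nat \<Rightarrow> (nat \<Rightarrow> 'a set) \<Rightarrow> 'a set set \<Rightarrow> bool" where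
  "removed_odd a m P R \<longleftrightarrow>
     (\<exists>P' P'' M M12 M23 M31.
        (\<forall>i\<in>{1, 2, 3}. P i = P' i \<union> P'' i \<and> P' i \<inter> P'' i = {} \<and>
           card (P' i) = a div 2 \<and> card (P'' i) = a div 2) \<and>
        perfect_matching_between (P' 1) (P'' 2) M12 \<and>
        perfect_matching_between (P' 2) (P'' 3) M23 \<and>
        perfect_matching_between (P' 3) (P'' 1) M31 \<and>
        (\<forall>i. even i \<and> 4 \<le> i \<and> i < m \<longrightarrow>
           perfect_matching_between (P i) (P (i + 1)) (M i)) \<and>
        R = M12 \<union> M23 \<union> M31 \<union> (\<Union>i\<in>{i. even i \<and> 4 \<le> i \<and> i < m}. M i))"

text \<open>\<open>is_Tstar a b \<chi> V E\<close>: the graph \<open>(V, E)\<close> is some \<open>T\<^sup>*\<close> of order \<open>n = a * \<chi> + b\<close>. The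
  construction depends on the chosen decomposition of \<open>n\<close> (the case \<open>b = \<chi>\<close> is allowed), so
  \<open>a\<close> and \<open>b\<close> are parameters instead of \<open>n\<close>.\<close>

definition is_Tstar :: "nat \<Rightarrow> nat \<Rightarrow> nat \<Rightarrow> 'a set \<Rightarrow> 'a set set \<Rightarrow> bool" where
  "is_Tstar a b \<chi> V E \<longleftrightarrow>
     (\<exists>P R. Tstar_parts a b \<chi> P \<and>
        V = (\<Union>i\<in>{1..\<chi>}. P i) \<and>
        E = complete_multipartite_edges \<chi> P - R \<and>
        (even (\<chi> - b) \<and> removed_even (\<chi> - b) P R \<or>
         odd (\<chi> - b) \<and> \<chi> - b \<ge> 3 \<and> even a \<and> removed_odd a (\<chi> - b) P R))"

end

theory Submission imports Defs begin

text \<open>In an \<open>r\<close>-regular graph of order \<open>n\<close> an independent set has at most \<open>n - r\<close> vertices. With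
  \<open>r = a * (\<chi> - 1) + b - 1\<close> and \<open>n < a * \<chi> + b\<close> this leaves at most \<open>a\<close> vertices in each of the
  \<open>\<chi>\<close> colour classes, and these are too few to make up \<open>n \<ge> r + 1\<close> vertices. In \<open>T\<^sup>*\<close> itself the
  removed edges form a perfect matching of the union of the small parts, which equalises the
  degrees; as \<open>a \<ge> 2\<close>, the parts still have a transversal that avoids the removed edges, and this
  clique forces \<open>\<chi>\<close> colours.\<close>

section \<open>Colourings, cliques and neighbourhoods\<close>

lemma chromatic_number_le:
  "proper_colouring V E k c \<Longrightarrow> chromatic_number V E \<le> k"
  unfolding chromatic_number_def by (rule Least_le) blast

text \<open>The \<open>LEAST\<close> in \<open>chromatic_number\<close> is attained: an injective
  numbering of the finite set \<open>V\<close> is a proper colouring, because every edge has two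
  distinct ends.\<close>

lemma proper_colouring_chromatic_number:
  assumes "simple_graph V E"
  obtains c where "proper_colouring V E (chromatic_number V E) c"
proof -
  from assms have fin: "finite V" and edge: "\<And>e. e \<in> E \<Longrightarrow> card e = 2"
    by (auto simp: simple_graph_def)
  from finite_imp_inj_to_nat_seg[OF fin] obtain f :: "'a \<Rightarrow> nat" and n
    where f: "f ` V = {i. i < n}" "inj_on f V" by blast
  have "f u \<noteq> f v" if "u \<in> V" "v \<in> V" "{u, v} \<in> E" for u v
  proof
    assume "f u = f v"
    then have "u = v" using f(2) that(1,2) by (simp add: inj_on_eq_iff)
    with edge[OF that(3)] show False by simp
  qed
  with f(1) have "proper_colouring V E n f" by (auto simp: proper_colouring_def)
  then have "\<exists>k c. proper_colouring V E k c" by blast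
  then have "\<exists>c. proper_colouring V E (chromatic_number V E) c"
    unfolding chromatic_number_def by (rule LeastI_ex)
  with that show thesis by blast
qed

text \<open>A proper colouring is injective on a clique.\<close>

lemma clique_le_proper_colouring:
  assumes "proper_colouring V E k c" and "K \<subseteq> V"
    and "\<And>u v. u \<in> K \<Longrightarrow> v \<in> K \<Longrightarrow> u \<noteq> v \<Longrightarrow> {u, v} \<in> E"
  shows "card K \<le> k"
proof -
  have "inj_on c K" using assms unfolding proper_colouring_def inj_on_def by blast
  moreover have "c ` K \<subseteq> {..<k}" using assms by (auto simp: proper_colouring_def)
  ultimately show ?thesis by (metis card_image card_mono card_lessThan finite_lessThan)
qed

lemma degree_eq_card_neighbours:
  assumes "simple_graph V E"
  shows "degree E v = card {u \<in> V. {v, u} \<in> E}"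
proof -
  have "{e \<in> E. v \<in> e} = (\<lambda>u. {v, u}) ` {u \<in> V. {v, u} \<in> E}"
  proof (intro equalityI subsetI)
    fix e assume "e \<in> {e \<in> E. v \<in> e}"
    then have e: "e \<in> E" "v \<in> e" "e \<subseteq> V" "card e = 2"
      using assms by (auto simp: simple_graph_def)
    then obtain x y where "e = {x, y}" by (meson card_2_iff)
    with e show "e \<in> (\<lambda>u. {v, u}) ` {u \<in> V. {v, u} \<in> E}"
      by (auto simp: insert_commute)
  qed auto
  moreover have "inj_on (\<lambda>u. {v, u}) {u \<in> V. {v, u} \<in> E}"
    by (auto simp: inj_on_def doubleton_eq_iff)
  ultimately show ?thesis by (simp add: degree_def card_image)
qed

section \<open>The lower bound on the order\<close>

text \<open>\<open>I\<close> and the neighbourhood of \<open>v\<close> are disjoint subsets of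
  \<open>V\<close>.\<close>

lemma card_independent_add_degree_le:
  assumes "simple_graph V E" and "I \<subseteq> V" and "v \<in> I"
    and "\<And>u. u \<in> I \<Longrightarrow> {v, u} \<notin> E"
  shows "card I + degree E v \<le> card V"
proof -
  have fin: "finite V" using assms(1) by (simp add: simple_graph_def)
  have "card I + card {u \<in> V. {v, u} \<in> E} = card (I \<union> {u \<in> V. {v, u} \<in> E})"
    using assms fin by (intro card_Un_disjoint[symmetric]) (auto intro: finite_subset)
  also have "\<dots> \<le> card V" using assms fin by (intro card_mono) auto
  finally show ?thesis by (simp add: degree_eq_card_neighbours[OF assms(1)])
qed

text \<open>Each of the \<chi> colour classes is independent, so a nonempty class has at most
  \<open>card V - r\<close> vertices; an empty one satisfies the bound trivially.\<close>

lemma r_chi_graph_order_le: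
  assumes "r_chi_graph r \<chi> V E"
  shows "card V \<le> \<chi> * (card V - r)"
proof -
  from assms have G: "simple_graph V E" and reg: "regular r V E"
    and \<chi>: "chromatic_number V E = \<chi>" by (auto simp: r_chi_graph_def)
  from proper_colouring_chromatic_number[OF G] \<chi>
  obtain c where c: "proper_colouring V E \<chi> c" by metis
  have fin: "finite V" using G by (simp add: simple_graph_def)
  have cls: "card {v \<in> V. c v = j} \<le> card V - r" for j
  proof (cases "{v \<in> V. c v = j} = {}")
    case False
    then obtain v where v: "v \<in> V" "c v = j" by blast
    have "{v, u} \<notin> E" if "u \<in> {v \<in> V. c v = j}" for u
      using c v that unfolding proper_colouring_def by (metis (mono_tags, lifting) mem_Collect_eq)
    then have "card {v \<in> V. c v = j} + degree E v \<le> card V"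
      using v by (intro card_independent_add_degree_le[OF G]) auto
    moreover have "degree E v = r" using reg v by (simp add: regular_def)
    ultimately show ?thesis by simp
  qed (simp only: card.empty le0)
  have "V = (\<Union>j<\<chi>. {v \<in> V. c v = j})" using c by (auto simp: proper_colouring_def)
  then have "card V \<le> (\<Sum>j<\<chi>. card {v \<in> V. c v = j})"
    using card_UN_le[of "{..<\<chi>}" "\<lambda>j. {v \<in> V. c v = j}"] by simp
  also have "\<dots> \<le> (\<Sum>j<\<chi>. card V - r)" by (intro sum_mono cls)
  finally show ?thesis by simp
qed

lemma r_chi_graph_order_ge:
  fixes a b \<chi> :: nat
  assumes "r_chi_graph (a * (\<chi> - 1) + b - 1) \<chi> V E" and "b > 1" and "\<chi> > 0"
  shows "a * \<chi> + b \<le> card V"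
proof (rule ccontr)
  assume less: "\<not> a * \<chi> + b \<le> card V"
  obtain k where k: "\<chi> = Suc k" using assms(3) gr0_implies_Suc by blast
  define d where "d = card V - (a * k + b - 1)"
  have le: "card V \<le> \<chi> * d" using r_chi_graph_order_le[OF assms(1)] by (simp add: d_def k)
  have "d \<le> a" using less by (simp add: d_def k)
  show False
  proof (cases "card V \<le> a * k + b - 1")
    \<comment> \<open>Here the truncated difference \<open>d\<close> is 0, which leaves only the
      empty graph; its chromatic number is 0.\<close>
    case True
    then have "d = 0" by (simp add: d_def)
    with le have "card V = 0" by simp
    with assms(1) have "V = {}" by (auto simp: r_chi_graph_def simple_graph_def)
    then have "proper_colouring V E 0 (\<lambda>_. 0)" by (simp add: proper_colouring_def)
    then have "\<chi> = 0" using chromatic_number_le assms(1) by (force simp: r_chi_graph_def)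
    with assms(3) show False by simp
  next
    case False
    \<comment> \<open>Now \<open>card V\<close> is exactly the degree plus \<open>d\<close>.
      Together with \<open>card V \<le> d + k * d\<close> and \<open>k * d \<le> a * k\<close> this
      gives \<open>b - 1 \<le> 0\<close>.\<close>
    then have "card V = d + a * k + b - 1" using assms(2) by (simp add: d_def)
    moreover have "k * d \<le> a * k" using \<open>d \<le> a\<close> by (simp add: mult.commute)
    moreover have "card V \<le> d + k * d" using le by (simp add: k)
    ultimately show False using assms(2) by linarith
  qed
qed

section \<open>Perfect matchings and transversals\<close>

text \<open>This forgets the bipartition in \<open>perfect_matching_between\<close>, so that
  matchings of disjoint vertex sets can be united into one matching of everything. That edges have
  two elements is supplied later by inclusion in \<open>complete_multipartite_edges\<close>.\<close>

definition matches :: "'a set \<Rightarrow> 'a set set \<Rightarrow> bool" where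
  "matches U R \<longleftrightarrow> (\<forall>e\<in>R. e \<subseteq> U) \<and> (\<forall>v\<in>U. \<exists>!e. e \<in> R \<and> v \<in> e)"

lemma perfect_matching_between_imp_matches:
  "perfect_matching_between X Y M \<Longrightarrow> matches (X \<union> Y) M"
  unfolding perfect_matching_between_def matches_def by blast

lemma perfect_matching_betweenE:
  assumes "perfect_matching_between X Y M" and "e \<in> M"
  obtains x y where "x \<in> X" "y \<in> Y" "e = {x, y}"
  using assms unfolding perfect_matching_between_def by blast

lemma matches_UN:
  assumes "\<And>k. k \<in> K \<Longrightarrow> matches (U k) (M k)"
    and "\<And>k l. k \<in> K \<Longrightarrow> l \<in> K \<Longrightarrow> k \<noteq> l \<Longrightarrow> U k \<inter> U l = {}"
  shows "matches (\<Union>k\<in>K. U k) (\<Union>k\<in>K. M k)"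
  unfolding matches_def
proof (intro conjI ballI)
  fix e assume "e \<in> (\<Union>k\<in>K. M k)"
  then show "e \<subseteq> (\<Union>k\<in>K. U k)" using assms(1) unfolding matches_def by blast
next
  fix v assume "v \<in> (\<Union>k\<in>K. U k)"
  then obtain k where k: "k \<in> K" "v \<in> U k" by blast
  \<comment> \<open>An edge of \<open>M l\<close> stays inside \<open>U l\<close>, so by
    disjointness only \<open>M k\<close> can contribute an edge at \<open>v\<close>.\<close>
  have "l = k" if "l \<in> K" "e \<in> M l" "v \<in> e" for l e
    using assms(1)[OF that(1)] assms(2)[OF that(1) k(1)] that k unfolding matches_def by blast
  then have "e \<in> (\<Union>k\<in>K. M k) \<and> v \<in> e \<longleftrightarrow> e \<in> M k \<and> v \<in> e" for e
    using k(1) by blast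
  moreover have "\<exists>!e. e \<in> M k \<and> v \<in> e"
    using assms(1)[OF k(1)] k(2) unfolding matches_def by blast
  ultimately show "\<exists>!e. e \<in> (\<Union>k\<in>K. M k) \<and> v \<in> e" by presburger
qed

lemma matches_Un:
  assumes "matches U R" and "matches U' R'" and "U \<inter> U' = {}"
  shows "matches (U \<union> U') (R \<union> R')"
  using matches_UN[of UNIV "\<lambda>k. if k then U else U'" "\<lambda>k. if k then R else R'"] assms
  by (simp add: UNIV_bool Un_commute Int_commute)

text \<open>A vertex \<open>x\<close> of \<open>X\<close> lies on a single edge of \<open>M\<close>,
  so it cannot be matched to both of two vertices of \<open>Y\<close>. This is how parts with at
  least two vertices enter the clique construction.\<close>

lemma perfect_matching_between_nonedge:
  assumes "perfect_matching_between X Y M" and "X \<noteq> {}" and "card Y \<ge> 2"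
  obtains x y where "x \<in> X" "y \<in> Y" "{x, y} \<notin> M"
proof -
  obtain x where x: "x \<in> X" using assms(2) by blast
  obtain y z where yz: "y \<in> Y" "z \<in> Y" "y \<noteq> z"
    using assms(3) card_le_Suc0_iff_eq[of Y] card.infinite[of Y] by fastforce
  have "{x, y} \<notin> M \<or> {x, z} \<notin> M"
  proof (rule ccontr)
    assume "\<not> ?thesis"
    moreover have "\<exists>!e. e \<in> M \<and> x \<in> e"
      using assms(1) x unfolding perfect_matching_between_def by simp
    ultimately have "{x, y} = {x, z}" by (metis insertI1)
    with yz show False by (auto simp: doubleton_eq_iff)
  qed
  then show thesis using that[OF x yz(1)] that[OF x yz(2)] by blast
qed

text \<open>Since \<open>S\<close> contains no two consecutive indices, the pairs \<open>i\<close>,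
  \<open>Suc i\<close> with \<open>i\<close> in \<open>S\<close> are disjoint, and a nonedge can be
  chosen for each pair independently.\<close>

lemma exists_transversal_avoiding:
  fixes Q :: "nat \<Rightarrow> 'a set"
  assumes "\<And>i. i \<in> I \<Longrightarrow> Q i \<noteq> {}"
    and "\<And>i. i \<in> S \<Longrightarrow> Suc i \<notin> S"
    and "\<And>i. i \<in> S \<Longrightarrow> \<exists>x\<in>Q i. \<exists>y\<in>Q (Suc i). {x, y} \<notin> M i"
  obtains f where "\<forall>i\<in>I. f i \<in> Q i" "\<forall>i\<in>S. {f i, f (Suc i)} \<notin> M i"
proof -
  from assms(3) obtain x y where xy: "\<And>i. i \<in> S \<Longrightarrow> x i \<in> Q i \<and> y i \<in> Q (Suc i) \<and> {x i, y i} \<notin> M i"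
    by metis
  \<comment> \<open>The first end of a pair takes \<open>x\<close>, the second end takes the
    \<open>y\<close> of the preceding index, and an index in no pair takes any element of its
    set.\<close>
  define f where "f i = (if i \<in> S then x i else if \<exists>j\<in>S. i = Suc j then y (i - 1)
    else (SOME v. v \<in> Q i))" for i
  have "f i \<in> Q i" if "i \<in> I" for i
    using xy assms(1)[OF that] by (auto simp: f_def some_in_eq)
  moreover have "{f i, f (Suc i)} \<notin> M i" if "i \<in> S" for i
    using xy[OF that] assms(2)[OF that] that by (auto simp: f_def)
  ultimately show thesis using that by blast
qed

section \<open>The complete multipartite graph on the parts\<close>

lemma Tstar_parts_index_eq:
  assumes "Tstar_parts a b \<chi> P" and "i \<in> {1..\<chi>}" "j \<in> {1..\<chi>}" "v \<in> P i" "v \<in> P j"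
  shows "i = j"
  using assms unfolding Tstar_parts_def by blast

lemma Tstar_parts_card_UN:
  assumes "Tstar_parts a b \<chi> P" and "b \<le> \<chi>"
  shows "card (\<Union>i\<in>{1..\<chi>}. P i) = a * \<chi> + b"
proof -
  have "card (\<Union>i\<in>{1..\<chi>}. P i) = (\<Sum>i\<in>{1..\<chi>}. card (P i))"
    using assms(1) by (intro card_UN_disjoint) (auto simp: Tstar_parts_def)
  \<comment> \<open>Every part counts \<open>a\<close>, and each of the \<open>b\<close> parts with
    index above \<open>\<chi> - b\<close> counts one more.\<close>
  also have "\<dots> = (\<Sum>i\<in>{1..\<chi>}. a + (if \<chi> - b < i then 1 else 0))"
    using assms(1) by (intro sum.cong) (auto simp: Tstar_parts_def)
  also have "\<dots> = a * \<chi> + card ({1..\<chi>} \<inter> {i. \<chi> - b < i})"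
    by (simp add: sum.distrib sum.If_cases)
  also have "{1..\<chi>} \<inter> {i. \<chi> - b < i} = {\<chi> - b<..\<chi>}" by auto
  finally show ?thesis using assms(2) by simp
qed

lemma complete_multipartite_edges_iff:
  assumes "Tstar_parts a b \<chi> P" and "i \<in> {1..\<chi>}" and "v \<in> P i"
  shows "{v, u} \<in> complete_multipartite_edges \<chi> P \<longleftrightarrow> u \<in> (\<Union>j\<in>{1..\<chi>}. P j) - P i"
proof
  assume "{v, u} \<in> complete_multipartite_edges \<chi> P"
  then obtain j k where "j \<in> {1..\<chi>}" "k \<in> {1..\<chi>}" "j \<noteq> k" "v \<in> P j" "u \<in> P k"
    unfolding complete_multipartite_edges_def by (auto simp: doubleton_eq_iff)
  then show "u \<in> (\<Union>j\<in>{1..\<chi>}. P j) - P i"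
    using Tstar_parts_index_eq[OF assms(1)] assms(2,3) by (metis DiffI UN_I)
next
  assume "u \<in> (\<Union>j\<in>{1..\<chi>}. P j) - P i"
  then obtain j where "j \<in> {1..\<chi>}" "u \<in> P j" "i \<noteq> j" by blast
  with assms(2,3) show "{v, u} \<in> complete_multipartite_edges \<chi> P"
    unfolding complete_multipartite_edges_def by blast
qed

lemma simple_graph_complete_multipartite:
  assumes "Tstar_parts a b \<chi> P"
  shows "simple_graph (\<Union>i\<in>{1..\<chi>}. P i) (complete_multipartite_edges \<chi> P)"
proof -
  have "e \<subseteq> (\<Union>i\<in>{1..\<chi>}. P i) \<and> card e = 2" if "e \<in> complete_multipartite_edges \<chi> P" for e
  proof -
    from that obtain i j u v where e: "e = {u, v}" "i \<in> {1..\<chi>}" "j \<in> {1..\<chi>}" "i \<noteq> j" "u \<in> P i" "v \<in> P j"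
      unfolding complete_multipartite_edges_def by blast
    then have "u \<noteq> v" using Tstar_parts_index_eq[OF assms] by blast
    then have "card e = 2" by (simp add: e(1))
    moreover have "e \<subseteq> (\<Union>i\<in>{1..\<chi>}. P i)" using e by blast
    ultimately show ?thesis by simp
  qed
  moreover have "finite (\<Union>i\<in>{1..\<chi>}. P i)"
    using assms unfolding Tstar_parts_def by (intro finite_UN_I) simp_all
  ultimately show ?thesis unfolding simple_graph_def by blast
qed

lemma degree_complete_multipartite:
  assumes "Tstar_parts a b \<chi> P" and "b \<le> \<chi>" and "i \<in> {1..\<chi>}" and "v \<in> P i"
  shows "degree (complete_multipartite_edges \<chi> P) v = a * \<chi> + b - card (P i)"
proof -
  have "{u \<in> (\<Union>j\<in>{1..\<chi>}. P j). {v, u} \<in> complete_multipartite_edges \<chi> P} = (\<Union>j\<in>{1..\<chi>}. P j) - P i"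
    using complete_multipartite_edges_iff[OF assms(1,3,4)] by auto
  moreover have "card ((\<Union>j\<in>{1..\<chi>}. P j) - P i) = a * \<chi> + b - card (P i)"
  proof -
    have "finite (P i)" "P i \<subseteq> (\<Union>j\<in>{1..\<chi>}. P j)"
      using assms(1,3) by (auto simp: Tstar_parts_def)
    then show ?thesis
      by (simp only: card_Diff_subset Tstar_parts_card_UN[OF assms(1,2)])
  qed
  ultimately show ?thesis
    by (simp add: degree_eq_card_neighbours[OF simple_graph_complete_multipartite[OF assms(1)]])
qed

section \<open>Removing a perfect matching of the small parts\<close>

text \<open>The common core of both parities. Before the removal, vertices in parts of size
  \<open>a\<close> have degree one larger than those in parts of size \<open>a + 1\<close>; removing
  \<open>R\<close> cancels the difference. Colouring by parts gives the upper bound \<chi>, and the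
  transversal \<open>f\<close> is a clique that gives the lower bound.\<close>

lemma r_chi_graph_multipartite_minus_matching:
  fixes a b \<chi> :: nat
  assumes parts: "Tstar_parts a b \<chi> P" and "b \<le> \<chi>"
    and R: "matches (\<Union>i\<in>{1..\<chi> - b}. P i) R" "R \<subseteq> complete_multipartite_edges \<chi> P"
    and f: "\<And>i. i \<in> {1..\<chi>} \<Longrightarrow> f i \<in> P i"
      "\<And>i j. i \<in> {1..\<chi>} \<Longrightarrow> j \<in> {1..\<chi>} \<Longrightarrow> i \<noteq> j \<Longrightarrow> {f i, f j} \<notin> R"
  shows "r_chi_graph (a * (\<chi> - 1) + b - 1) \<chi> (\<Union>i\<in>{1..\<chi>}. P i)
    (complete_multipartite_edges \<chi> P - R)"
proof -
  define V where "V = (\<Union>i\<in>{1..\<chi>}. P i)"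
  define C where "C = complete_multipartite_edges \<chi> P"
  have G: "simple_graph V C" unfolding V_def C_def by (rule simple_graph_complete_multipartite[OF parts])
  have finC: "finite C"
  proof (rule finite_subset)
    show "C \<subseteq> Pow V" "finite (Pow V)" using G by (auto simp: simple_graph_def)
  qed
  have deg: "degree (C - R) v = a * (\<chi> - 1) + b - 1" if v: "v \<in> V" for v
  proof -
    obtain i where i: "i \<in> {1..\<chi>}" "v \<in> P i" using v unfolding V_def by blast
    have "{e \<in> C - R. v \<in> e} = {e \<in> C. v \<in> e} - {e \<in> R. v \<in> e}" by blast
    moreover have "{e \<in> R. v \<in> e} \<subseteq> {e \<in> C. v \<in> e}" using R(2) C_def by blast
    ultimately have "degree (C - R) v = degree C v - card {e \<in> R. v \<in> e}"
      using finC unfolding degree_def by (simp add: card_Diff_subset finite_subset)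
    also have "degree C v = a * \<chi> + b - card (P i)"
      using degree_complete_multipartite[OF parts \<open>b \<le> \<chi>\<close> i] by (simp add: C_def)
    \<comment> \<open>\<open>R\<close> has exactly one edge at each vertex of a small part and stays
      inside the small parts, so a vertex of a large part loses nothing.\<close>
    also have "card {e \<in> R. v \<in> e} = (if i \<le> \<chi> - b then 1 else 0)"
    proof (cases "i \<le> \<chi> - b")
      case True
      with i have "v \<in> (\<Union>i\<in>{1..\<chi> - b}. P i)" by force
      with R(1) have "\<exists>!e. e \<in> R \<and> v \<in> e" unfolding matches_def by blast
      then obtain e where "{e \<in> R. v \<in> e} = {e}" by blast
      with True show ?thesis by simp
    next
      case False
      have "v \<notin> (\<Union>i\<in>{1..\<chi> - b}. P i)"
        using Tstar_parts_index_eq[OF parts i(1) _ i(2)] False by force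
      then have "{e \<in> R. v \<in> e} = {}" using R(1) unfolding matches_def by blast
      with False show ?thesis by (simp only: card.empty if_False)
    qed
    also have "card (P i) = (if i \<le> \<chi> - b then a else a + 1)"
      using parts i unfolding Tstar_parts_def by blast
    finally show ?thesis using i by (cases \<chi>) (auto split: if_splits)
  qed
  have "chromatic_number V (C - R) = \<chi>"
  proof (rule antisym)
    \<comment> \<open>The index of the part is unique by disjointness; parts are numbered from 1 but
      colours from 0.\<close>
    define c where "c v = (THE i. i \<in> {1..\<chi>} \<and> v \<in> P i) - 1" for v
    have c: "c v = i - 1" if "i \<in> {1..\<chi>}" "v \<in> P i" for i v
      unfolding c_def using that Tstar_parts_index_eq[OF parts] by (subst the_equality) auto
    have "proper_colouring V (C - R) \<chi> c" unfolding proper_colouring_def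
    proof (intro conjI ballI impI)
      fix v assume "v \<in> V"
      then show "c v < \<chi>" using c unfolding V_def by force
    next
      fix u v assume "u \<in> V" "v \<in> V" "{u, v} \<in> C - R"
      then obtain i j where ij: "i \<in> {1..\<chi>}" "j \<in> {1..\<chi>}" "u \<in> P i" "v \<in> P j"
        unfolding V_def by blast
      then have "i \<noteq> j"
        using complete_multipartite_edges_iff[OF parts ij(1,3), of v] \<open>{u, v} \<in> C - R\<close>
        unfolding C_def by blast
      with ij show "c u \<noteq> c v" using c by force
    qed
    then show "chromatic_number V (C - R) \<le> \<chi>" by (rule chromatic_number_le)
  next
    \<comment> \<open>Values of \<open>f\<close> at different indices lie in disjoint parts, so the
      clique really has \<chi> vertices.\<close>
    have inj: "inj_on f {1..\<chi>}"
      using Tstar_parts_index_eq[OF parts] f(1) by (intro inj_onI) metis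
    have "simple_graph V (C - R)" using G by (auto simp: simple_graph_def)
    then obtain c where "proper_colouring V (C - R) (chromatic_number V (C - R)) c"
      by (rule proper_colouring_chromatic_number)
    then have "card (f ` {1..\<chi>}) \<le> chromatic_number V (C - R)"
    proof (rule clique_le_proper_colouring)
      show "f ` {1..\<chi>} \<subseteq> V" using f(1) unfolding V_def by blast
      fix u v assume "u \<in> f ` {1..\<chi>}" "v \<in> f ` {1..\<chi>}" "u \<noteq> v"
      then obtain i j where "i \<in> {1..\<chi>}" "j \<in> {1..\<chi>}" "i \<noteq> j" "u = f i" "v = f j" by blast
      then show "{u, v} \<in> C - R"
        using f unfolding C_def complete_multipartite_edges_def by blast
    qed
    then show "\<chi> \<le> chromatic_number V (C - R)" by (simp only: card_image[OF inj] card_atLeastAtMost diff_Suc_1)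
  qed
  with G deg show ?thesis
    unfolding r_chi_graph_def regular_def V_def[symmetric] C_def[symmetric]
    by (auto simp: simple_graph_def)
qed

section \<open>Matchings between consecutive parts\<close>

lemma perfect_matching_between_parts_subset:
  assumes "perfect_matching_between X Y M" and "X \<subseteq> P i" "Y \<subseteq> P j"
    and "i \<in> {1..\<chi>}" "j \<in> {1..\<chi>}" "i \<noteq> j"
  shows "M \<subseteq> complete_multipartite_edges \<chi> P"
proof
  fix e assume "e \<in> M"
  with assms(1) obtain x y where "x \<in> X" "y \<in> Y" "e = {x, y}" by (rule perfect_matching_betweenE)
  with assms(2-) show "e \<in> complete_multipartite_edges \<chi> P"
    unfolding complete_multipartite_edges_def by blast
qed

text \<open>The consecutive pairs \<open>{k, k + 1}\<close> with \<open>k \<in> S\<close> tile the indices \<open>s, \<dots>, m\<close>.\<close>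

lemma consecutive_pairs:
  fixes P :: "nat \<Rightarrow> 'a set"
  assumes parts: "Tstar_parts a b \<chi> P" and "m \<le> \<chi>" and "0 < s" and "even (m + 1 - s)"
    and S: "S = {k. s \<le> k \<and> k < m \<and> even (k - s)}"
    and M: "\<forall>k\<in>S. perfect_matching_between (P k) (P (Suc k)) (M k)"
  shows "matches (\<Union>i\<in>{s..m}. P i) (\<Union>k\<in>S. M k)"
    and "(\<Union>k\<in>S. M k) \<subseteq> complete_multipartite_edges \<chi> P"
    and "\<And>f i j. \<lbrakk>\<forall>i\<in>{1..\<chi>}. f i \<in> P i; \<forall>k\<in>S. {f k, f (Suc k)} \<notin> M k;
      i \<in> {1..\<chi>}; j \<in> {1..\<chi>}\<rbrakk> \<Longrightarrow> {f i, f j} \<notin> (\<Union>k\<in>S. M k)"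
proof -
  have S_in: "k \<in> {1..\<chi>}" "Suc k \<in> {1..\<chi>}" if "k \<in> S" for k
    using that assms(2,3) by (auto simp: S)
  have "(\<Union>i\<in>{s..m}. P i) = (\<Union>k\<in>S. P k \<union> P (Suc k))"
  proof (intro equalityI subsetI)
    fix v assume "v \<in> (\<Union>i\<in>{s..m}. P i)"
    then obtain i where i: "s \<le> i" "i \<le> m" "v \<in> P i" by auto
    show "v \<in> (\<Union>k\<in>S. P k \<union> P (Suc k))"
    \<comment> \<open>An even offset from \<open>s\<close> marks the first index of a pair, an odd
      offset the second. The last index \<open>m\<close> has odd offset, so no pair runs past
      it.\<close>
    proof (cases "even (i - s)")
      case True
      with i assms(4) have "i \<noteq> m" by (auto simp: Suc_diff_le)
      with True i have "i \<in> S" by (auto simp: S)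
      with i show ?thesis by blast
    next
      case False
      then obtain k where k: "i = Suc k" by (cases i) auto
      with False i have "s \<noteq> i" by auto
      with False i k have "k \<in> S" by (auto simp: S Suc_diff_le)
      with i k show ?thesis by blast
    qed
  qed (use S in force)
  moreover have "matches (\<Union>k\<in>S. P k \<union> P (Suc k)) (\<Union>k\<in>S. M k)"
  proof (rule matches_UN)
    fix k assume "k \<in> S"
    then show "matches (P k \<union> P (Suc k)) (M k)"
      using M by (simp add: perfect_matching_between_imp_matches)
  next
    fix k l assume kl: "k \<in> S" "l \<in> S" "k \<noteq> l"
    \<comment> \<open>Offsets of members of \<open>S\<close> are all even, so two members never
      differ by one.\<close>
    then have "Suc k \<noteq> l" "k \<noteq> Suc l" by (auto simp: S Suc_diff_le)
    then show "(P k \<union> P (Suc k)) \<inter> (P l \<union> P (Suc l)) = {}"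
      using kl S_in[OF kl(1)] S_in[OF kl(2)] Tstar_parts_index_eq[OF parts] by blast
  qed
  ultimately show "matches (\<Union>i\<in>{s..m}. P i) (\<Union>k\<in>S. M k)" by simp
  have "M k \<subseteq> complete_multipartite_edges \<chi> P" if "k \<in> S" for k
    using M that S_in[OF that]
    by (intro perfect_matching_between_parts_subset[of "P k" "P (Suc k)" _ P k "Suc k"]) auto
  then show "(\<Union>k\<in>S. M k) \<subseteq> complete_multipartite_edges \<chi> P" by blast
  fix f i j
  assume f: "\<forall>i\<in>{1..\<chi>}. f i \<in> P i" "\<forall>k\<in>S. {f k, f (Suc k)} \<notin> M k"
    and ij: "i \<in> {1..\<chi>}" "j \<in> {1..\<chi>}"
  show "{f i, f j} \<notin> (\<Union>k\<in>S. M k)"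
  proof
    assume "{f i, f j} \<in> (\<Union>k\<in>S. M k)"
    then obtain k where k: "k \<in> S" "{f i, f j} \<in> M k" by blast
    obtain x y where "x \<in> P k" "y \<in> P (Suc k)" "{f i, f j} = {x, y}"
      using perfect_matching_betweenE[OF bspec[OF M k(1)] k(2)] .
    \<comment> \<open>Disjointness of the parts determines the indices from the ends of the edge, up
      to swapping the ends.\<close>
    then have "i = k \<and> j = Suc k \<or> i = Suc k \<and> j = k"
      using Tstar_parts_index_eq[OF parts] f(1) ij S_in[OF k(1)]
      by (metis doubleton_eq_iff)
    with f(2) k show False by (auto simp: insert_commute)
  qed
qed

section \<open>The two parities of \<open>\<chi> - b\<close>\<close>

text \<open>The pairs (1,2), (3,4), ... tile all small parts. As \<open>a \<ge> 2\<close>, every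
  matching misses some pair of vertices, and these nonedges of the matchings supply the
  clique.\<close>

lemma r_chi_graph_removed_even:
  fixes a b \<chi> :: nat
  assumes parts: "Tstar_parts a b \<chi> P" and "b \<le> \<chi>" and "a \<ge> 2" and "even (\<chi> - b)"
    and "removed_even (\<chi> - b) P R"
  shows "r_chi_graph (a * (\<chi> - 1) + b - 1) \<chi> (\<Union>i\<in>{1..\<chi>}. P i)
    (complete_multipartite_edges \<chi> P - R)"
proof -
  define m where "m = \<chi> - b"
  define S where "S = {k. odd k \<and> k < m}"
  from assms(5) obtain M
    where M: "\<forall>k\<in>S. perfect_matching_between (P k) (P (Suc k)) (M k)"
      and R: "R = (\<Union>k\<in>S. M k)"
    unfolding removed_even_def m_def[symmetric] S_def by auto
  have S: "S = {k. 1 \<le> k \<and> k < m \<and> even (k - 1)}" by (auto simp: S_def elim: oddE)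
  have "m \<le> \<chi>" "even (m + 1 - 1)" using assms(4) by (auto simp: m_def)
  note pairs = consecutive_pairs[OF parts this(1) zero_less_one this(2) S M]
  have card_P: "card (P i) \<ge> 2" "finite (P i)" if "i \<in> {1..\<chi>}" for i
    using parts that assms(3) by (auto simp: Tstar_parts_def)
  have nonedge: "\<exists>x\<in>P k. \<exists>y\<in>P (Suc k). {x, y} \<notin> M k" if "k \<in> S" for k
  proof -
    have k: "k \<in> {1..\<chi>}" "Suc k \<in> {1..\<chi>}" using that \<open>m \<le> \<chi>\<close> by (auto simp: S)
    have "P k \<noteq> {}" using card_P(1)[OF k(1)] by auto
    then show ?thesis
      using perfect_matching_between_nonedge[OF bspec[OF M that]] card_P(1)[OF k(2)] by metis
  qed
  have nonempty: "P i \<noteq> {}" if "i \<in> {1..\<chi>}" for i using card_P(1)[OF that] by auto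
  have no_Suc: "Suc i \<notin> S" if "i \<in> S" for i using that by (simp add: S_def)
  obtain f where f: "\<forall>i\<in>{1..\<chi>}. f i \<in> P i" "\<forall>k\<in>S. {f k, f (Suc k)} \<notin> M k"
    by (rule exists_transversal_avoiding[of _ P S M, OF nonempty no_Suc nonedge])
  show ?thesis
    by (rule r_chi_graph_multipartite_minus_matching[OF parts assms(2), of R f])
      (use pairs(1,2) pairs(3)[OF f] f R m_def in auto)
qed

text \<open>The three half matchings use each of the six halves once, so they match the first three
  parts perfectly; the parts from 4 on are paired as in the even case. Each edge of a half matching
  has an end in some \<open>P'' l\<close>, so a transversal taking its first three vertices from
  \<open>P' 1\<close>, \<open>P' 2\<close>, \<open>P' 3\<close> avoids all of them.\<close>

lemma r_chi_graph_removed_odd: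
  fixes a b \<chi> :: nat
  assumes parts: "Tstar_parts a b \<chi> P" and "b \<le> \<chi>" and "a \<ge> 2" and "odd (\<chi> - b)"
    and "\<chi> - b \<ge> 3" and "removed_odd a (\<chi> - b) P R"
  shows "r_chi_graph (a * (\<chi> - 1) + b - 1) \<chi> (\<Union>i\<in>{1..\<chi>}. P i)
    (complete_multipartite_edges \<chi> P - R)"
proof -
  define m where "m = \<chi> - b"
  define S where "S = {k. even k \<and> 4 \<le> k \<and> k < m}"
  from assms(6) obtain P' P'' M M12 M23 M31
    where halves: "\<forall>i\<in>{1, 2, 3}. P i = P' i \<union> P'' i \<and> P' i \<inter> P'' i = {} \<and>
        card (P' i) = a div 2 \<and> card (P'' i) = a div 2"
      and M12: "perfect_matching_between (P' 1) (P'' 2) M12"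
      and M23: "perfect_matching_between (P' 2) (P'' 3) M23"
      and M31: "perfect_matching_between (P' 3) (P'' 1) M31"
      and M': "\<forall>k. even k \<and> 4 \<le> k \<and> k < m \<longrightarrow>
        perfect_matching_between (P k) (P (k + 1)) (M k)"
      and R: "R = M12 \<union> M23 \<union> M31 \<union> (\<Union>k\<in>S. M k)"
    unfolding removed_odd_def m_def[symmetric] S_def[symmetric] by (elim exE conjE) (rule that, assumption+)
  have M: "\<forall>k\<in>S. perfect_matching_between (P k) (P (Suc k)) (M k)"
    using M' by (simp add: S_def)
  have S: "S = {k. 4 \<le> k \<and> k < m \<and> even (k - 4)}" by (auto simp: S_def)
  \<comment> \<open>For \<open>m = 3\<close> the difference \<open>m + 1 - 4\<close> is 0: the range
    \<open>{4..m}\<close> and the set \<open>S\<close> are empty.\<close>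
  have m: "m \<le> \<chi>" "even (m + 1 - 4)" "3 \<le> m" using assms(4,5) by (auto simp: m_def)
  note pairs = consecutive_pairs[OF parts m(1) zero_less_numeral m(2) S M]
  have halves_sub: "P' i \<subseteq> P i" "P'' i \<subseteq> P i" "P' i \<inter> P'' i = {}" "P i = P' i \<union> P'' i"
    if "i \<in> {1, 2, 3}" for i
    using halves that by auto
  have sub: "P' 1 \<subseteq> P 1" "P'' 1 \<subseteq> P 1" "P' 2 \<subseteq> P 2" "P'' 2 \<subseteq> P 2" "P' 3 \<subseteq> P 3" "P'' 3 \<subseteq> P 3"
    using halves_sub by simp_all
  have h: "P' 1 \<inter> P'' 1 = {}" "P' 2 \<inter> P'' 2 = {}" "P' 3 \<inter> P'' 3 = {}"
    "P 1 = P' 1 \<union> P'' 1" "P 2 = P' 2 \<union> P'' 2" "P 3 = P' 3 \<union> P'' 3"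
    using halves_sub(3,4) by simp_all
  have card_P: "card (P i) \<ge> 2" if "i \<in> {1..\<chi>}" for i
    using parts that assms(3) by (auto simp: Tstar_parts_def)
  have idx: "1 \<in> {1..\<chi>}" "2 \<in> {1..\<chi>}" "3 \<in> {1..\<chi>}" using m by auto
  have disj: "P i \<inter> P j = {}" if "i \<in> {1..\<chi>}" "j \<in> {1..\<chi>}" "i \<noteq> j" for i j
    using Tstar_parts_index_eq[OF parts that(1,2)] that(3) by blast
  have d: "P 1 \<inter> P 2 = {}" "P 1 \<inter> P 3 = {}" "P 2 \<inter> P 3 = {}"
    using disj idx by simp_all
  have "matches (P' 1 \<union> P'' 2 \<union> (P' 2 \<union> P'' 3) \<union> (P' 3 \<union> P'' 1)) (M12 \<union> M23 \<union> M31)"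
  proof (rule matches_Un[OF matches_Un])
    show "(P' 1 \<union> P'' 2) \<inter> (P' 2 \<union> P'' 3) = {}"
      using d sub h(2) by blast
    show "(P' 1 \<union> P'' 2 \<union> (P' 2 \<union> P'' 3)) \<inter> (P' 3 \<union> P'' 1) = {}"
      using d sub h(1,3) by blast
  qed (rule M12 M23 M31 perfect_matching_between_imp_matches)+
  moreover have "P' 1 \<union> P'' 2 \<union> (P' 2 \<union> P'' 3) \<union> (P' 3 \<union> P'' 1) = P 1 \<union> P 2 \<union> P 3"
    unfolding h(4-6) by blast
  moreover have "P 1 \<union> P 2 \<union> P 3 = (\<Union>i\<in>{1..3}. P i)"
  proof -
    have "{1..3} = {1, 2, 3::nat}" by auto
    then show ?thesis by auto
  qed
  moreover have "(\<Union>i\<in>{1..3}. P i) \<inter> (\<Union>i\<in>{4..m}. P i) = {}"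
  proof -
    have "P i \<inter> P j = {}" if "i \<in> {1..3}" "j \<in> {4..m}" for i j
      using that m(1,3) by (intro disj) auto
    then show ?thesis by blast
  qed
  ultimately have "matches ((\<Union>i\<in>{1..3}. P i) \<union> (\<Union>i\<in>{4..m}. P i)) R"
    using matches_Un pairs(1) unfolding R by metis
  moreover have "(\<Union>i\<in>{1..3}. P i) \<union> (\<Union>i\<in>{4..m}. P i) = (\<Union>i\<in>{1..m}. P i)"
  proof -
    have "{1..m} = {1..3} \<union> {4..m}" using m(3) by auto
    then show ?thesis by (simp add: UN_Un)
  qed
  ultimately have match: "matches (\<Union>i\<in>{1..\<chi> - b}. P i) R" by (simp add: m_def)
  have R_sub: "R \<subseteq> complete_multipartite_edges \<chi> P"
    unfolding R using pairs(2) idx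
      perfect_matching_between_parts_subset[OF M12 sub(1,4) idx(1,2)]
      perfect_matching_between_parts_subset[OF M23 sub(3,6) idx(2,3)]
      perfect_matching_between_parts_subset[OF M31 sub(5,2) idx(3,1)] by simp
  \<comment> \<open>Restricting the choice to \<open>P' i\<close> in the first three parts keeps the
    transversal out of every \<open>P''\<close> half, while the later parts remain
    unrestricted.\<close>
  define Q where "Q i = (if i \<le> 3 then P' i else P i)" for i
  have nonedge: "\<exists>x\<in>Q k. \<exists>y\<in>Q (Suc k). {x, y} \<notin> M k" if "k \<in> S" for k
  proof -
    have k: "k \<in> {1..\<chi>}" "Suc k \<in> {1..\<chi>}" "k > 3" using that \<open>m \<le> \<chi>\<close> by (auto simp: S)
    have "P k \<noteq> {}" using card_P(1)[OF k(1)] by auto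
    then have "\<exists>x\<in>P k. \<exists>y\<in>P (Suc k). {x, y} \<notin> M k"
      using perfect_matching_between_nonedge[OF bspec[OF M that]] card_P(1)[OF k(2)] by metis
    with k(3) show ?thesis by (simp add: Q_def)
  qed
  have Q_sub: "Q i \<subseteq> P i" "Q i \<noteq> {}" if "i \<in> {1..\<chi>}" for i
  proof -
    have "i \<in> {1, 2, 3}" if "i \<le> 3" using that \<open>i \<in> {1..\<chi>}\<close> by auto
    \<comment> \<open>This makes the halves \<open>P' i\<close> nonempty.\<close>
    moreover have "a div 2 \<noteq> 0" using assms(3) by simp
    ultimately show "Q i \<subseteq> P i" "Q i \<noteq> {}"
      using halves halves_sub(1) card_P[OF that] by (auto simp: Q_def)
  qed
  have no_Suc: "Suc i \<notin> S" if "i \<in> S" for i using that by (simp add: S_def)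
  obtain f where f: "\<forall>i\<in>{1..\<chi>}. f i \<in> Q i" "\<forall>k\<in>S. {f k, f (Suc k)} \<notin> M k"
    by (rule exists_transversal_avoiding[of _ Q S M, OF Q_sub(2) no_Suc nonedge])
  have fP: "\<forall>i\<in>{1..\<chi>}. f i \<in> P i" using f(1) Q_sub(1) by blast
  have f_not: "f i \<notin> P'' j" if "i \<in> {1..\<chi>}" "j \<in> {1, 2, 3}" for i j
  proof
    assume *: "f i \<in> P'' j"
    have "j \<in> {1..\<chi>}" using that(2) idx by auto
    then have "i = j"
      using Tstar_parts_index_eq[OF parts that(1)] fP that(1) halves_sub(2)[OF that(2)] * by blast
    with bspec[OF f(1) that(1)] that(2) have "f i \<in> P' j" by (auto simp: Q_def)
    with * halves_sub(3)[OF that(2)] show False by blast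
  qed
  have f_avoid: "{f i, f j} \<notin> N"
    \<comment> \<open>All three half matchings have this form, with \<open>l\<close> equal to 2, 3
      and 1 in turn.\<close>
    if "i \<in> {1..\<chi>}" "j \<in> {1..\<chi>}" "perfect_matching_between X (P'' l) N" "l \<in> {1, 2, 3}" for i j l X N
    using perfect_matching_betweenE[OF that(3), of "{f i, f j}"]
      f_not[OF that(1,4)] f_not[OF that(2,4)] by (metis doubleton_eq_iff)
  have "{f i, f j} \<notin> R" if "i \<in> {1..\<chi>}" "j \<in> {1..\<chi>}" for i j
    using f_avoid[OF that M12] f_avoid[OF that M23] f_avoid[OF that M31] pairs(3)[OF fP f(2) that]
    unfolding R by simp
  with fP show ?thesis
    by (intro r_chi_graph_multipartite_minus_matching[OF parts assms(2) match R_sub, of f]) auto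
qed

section \<open>Extremality\<close>

theorem theorem8:
  fixes a b \<chi> :: nat and V :: "'a set" and E :: "'a set set"
  assumes "\<chi> \<ge> 3" and "\<chi> \<ge> b" and "b > 1" and "a \<ge> 2"
    and "even (\<chi> - b) \<or> (\<chi> - b \<ge> 3 \<and> odd (\<chi> - b) \<and> a > 2 \<and> even a)"
    and "is_Tstar a b \<chi> V E"
  shows "card V = a * \<chi> + b \<and>
    extremal_graph TYPE('b) (a * (\<chi> - 1) + b - 1) \<chi> V E"
proof -
  from assms(6) obtain P R where parts: "Tstar_parts a b \<chi> P"
    and V: "V = (\<Union>i\<in>{1..\<chi>}. P i)"
    and E: "E = complete_multipartite_edges \<chi> P - R"
    and R: "even (\<chi> - b) \<and> removed_even (\<chi> - b) P R \<or>
      odd (\<chi> - b) \<and> \<chi> - b \<ge> 3 \<and> even a \<and> removed_odd a (\<chi> - b) P R"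
    unfolding is_Tstar_def by blast
  have card: "card V = a * \<chi> + b" unfolding V by (rule Tstar_parts_card_UN[OF parts assms(2)])
  have "r_chi_graph (a * (\<chi> - 1) + b - 1) \<chi> V E"
    unfolding V E using R r_chi_graph_removed_even[OF parts assms(2,4)]
      r_chi_graph_removed_odd[OF parts assms(2,4)] by blast
  \<comment> \<open>\<open>r_chi_graph_order_ge\<close> holds for every vertex type, so it bounds
    the competitors over \<open>'b\<close> by the order just computed for \<open>V\<close>.\<close>
  with card show ?thesis
    unfolding extremal_graph_def using r_chi_graph_order_ge assms(1,3) by fastforce
qed

end
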